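(* Let $0<\theta<1$ be fixed, and let $\sigma$ be a non-decreasing sigmoidal function satisfying: $\sigma(x)-1/2$ is odd; $\sigma\in C^2(\mathbb{R})$ is concave for $x\ge0$; and $\sigma(x)=\mathcal{O}(|x|^{-1-\alpha})$ as $x\to-\infty$ with $\alpha>\theta/(1-\theta)\ge2$. Let $N,M$ be positive integers and let $\widetilde f:[0,N]\times[0,M]\to\mathbb{R}$ be a digital image function, i.e. $\widetilde f=\sum_{i=1}^N\sum_{j=1}^M F_{i,j}\chi_{i,j}$ with $F_{i,j}\in\{0,1,\dots,255\}$. Then there is a constant $K>0$, independent of $n$, such that for all sufficiently large $n\in\mathbb{N}$ $$|1-\mathrm{cSSIM}(\widetilde f(\cdot),F_n(\widetilde f,\cdot))|\ \le\ c_f\,255^2\,M\,N\,\frac{K}{n^{\theta}},$$ where $c_f=\frac{4}{\sigma_{\widetilde f}^2+c_2}+\frac{1}{\mu_{\widetilde f}^2+c_1}$.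
   Context: A sigmoidal function is $\sigma:\mathbb{R}\to\mathbb{R}$ with $\lim_{x\to-\infty}\sigma(x)=0$ and $\lim_{x\to+\infty}\sigma(x)=1$. Let $I=[0,N]\times[0,M]$. For $1\le i\le N$, $1\le j\le M$, $\chi_{i,j}$ is the characteristic function of the unit pixel which is the product of $[i-1,i)$ (closed on the right if $i=N$) and $[j-1,j)$ (closed on the right if $j=M$); these pixels partition $I$. Set $\phi_\sigma(x)=\frac12[\sigma(x+1)-\sigma(x-1)]$ for $x\in\mathbb{R}$, $\Psi_\sigma(\mathtt{x})=\phi_\sigma(x_1)\phi_\sigma(x_2)$ for $\mathtt{x}=(x_1,x_2)\in\mathbb{R}^2$, and $\mathcal{A}_n=\{\mathtt{k}\in\mathbb{Z}^2:0\le k_1\le nN,\ 0\le k_2\le nM\}$. The neural network operators are $$F_n(f,\mathtt{x})=\frac{\sum_{\mathtt{k}\in\mathcal{A}_n}f(\mathtt{k}/n)\,\Psi_\sigma(n\mathtt{x}-\mathtt{k})}{\sum_{\mathtt{k}\in\mathcal{A}_n}\Psi_\sigma(n\mathtt{x}-\mathtt{k})},\qquad \mathtt{x}\in I,\ \mathtt{k}/n=(k_1/n,k_2/n).$$ Continuous SSIM: fix constants $c_1,c_2>0$ and let $\nu$ be the normalized Lebesgue (probability) measure on $I$. For non-negative $f,g\in L^2(I)$, $$\mathrm{cSSIM}(f,g)=\frac{2\mu_f\mu_g+c_1}{\mu_f^2+\mu_g^2+c_1}\cdot\frac{2\sigma_{fg}+c_2}{\sigma_f^2+\sigma_g^2+c_2},$$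 where $\mu_f=\int_I f\,d\nu$, $\sigma_{fg}=\int_I(f-\mu_f)(g-\mu_g)\,d\nu$ and $\sigma_f^2=\sigma_{ff}$. *)

theory Defs
  imports "HOL-Analysis.Analysis" "HOL-Library.Landau_Symbols"
begin

definition sigmoidal :: "(real \<Rightarrow> real) \<Rightarrow> bool" where
  "sigmoidal \<sigma> \<longleftrightarrow> (\<sigma> \<longlongrightarrow> 0) at_bot \<and> (\<sigma> \<longlongrightarrow> 1) at_top"

definition C2_real :: "(real \<Rightarrow> real) \<Rightarrow> bool" where
  "C2_real f \<longleftrightarrow> (\<exists>f' f''.
      (\<forall>x. (f has_real_derivative f' x) (at x)) \<and>
      (\<forall>x. (f' has_real_derivative f'' x) (at x)) \<and>
      continuous_on UNIV f'')"

definition image_domain :: "nat \<Rightarrow> nat \<Rightarrow> (real \<times> real) set" where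
  "image_domain N M = {0..real N} \<times> {0..real M}"

definition pixel_side :: "nat \<Rightarrow> nat \<Rightarrow> real set" where
  "pixel_side N i = (if i = N then {real i - 1..real i} else {real i - 1..<real i})"

definition pixel :: "nat \<Rightarrow> nat \<Rightarrow> nat \<Rightarrow> nat \<Rightarrow> (real \<times> real) set" where
  "pixel N M i j = pixel_side N i \<times> pixel_side M j"

(* Only the values of f on the domain are constrained; all notions below depend on f only
   through these values. *)
definition digital_image :: "nat \<Rightarrow> nat \<Rightarrow> (real \<times> real \<Rightarrow> real) \<Rightarrow> bool" where
  "digital_image N M f \<longleftrightarrow> (\<exists>F :: nat \<Rightarrow> nat \<Rightarrow> nat.
      (\<forall>i\<in>{1..N}. \<forall>j\<in>{1..M}. F i j \<in> {0..255}) \<and>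
      (\<forall>x\<in>image_domain N M.
         f x = (\<Sum>i=1..N. \<Sum>j=1..M. real (F i j) * indicator (pixel N M i j) x)))"

definition phi :: "(real \<Rightarrow> real) \<Rightarrow> real \<Rightarrow> real" where
  "phi \<sigma> x = (1/2) * (\<sigma> (x + 1) - \<sigma> (x - 1))"

definition Psi :: "(real \<Rightarrow> real) \<Rightarrow> real \<times> real \<Rightarrow> real" where
  "Psi \<sigma> x = phi \<sigma> (fst x) * phi \<sigma> (snd x)"

definition grid :: "nat \<Rightarrow> nat \<Rightarrow> nat \<Rightarrow> (int \<times> int) set" where
  "grid N M n = {k. 0 \<le> fst k \<and> fst k \<le> int (n * N) \<and> 0 \<le> snd k \<and> snd k \<le> int (n * M)}"

definition int_vec :: "int \<times> int \<Rightarrow> real \<times> real" where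
  "int_vec k = (real_of_int (fst k), real_of_int (snd k))"

definition NN_op ::
  "(real \<Rightarrow> real) \<Rightarrow> nat \<Rightarrow> nat \<Rightarrow> nat \<Rightarrow> (real \<times> real \<Rightarrow> real) \<Rightarrow> real \<times> real \<Rightarrow> real" where
  "NN_op \<sigma> N M n f x =
     (\<Sum>k\<in>grid N M n. f (int_vec k /\<^sub>R real n) * Psi \<sigma> (real n *\<^sub>R x - int_vec k)) /
     (\<Sum>k\<in>grid N M n. Psi \<sigma> (real n *\<^sub>R x - int_vec k))"

(* A measure whose space is the domain itself, so measurability and integrals
   ignore values outside it. *)
definition nu :: "nat \<Rightarrow> nat \<Rightarrow> (real \<times> real) measure" where
  "nu N M = uniform_measure (lebesgue_on (image_domain N M)) (image_domain N M)"

definition mean :: "nat \<Rightarrow> nat \<Rightarrow> (real \<times> real \<Rightarrow> real) \<Rightarrow> real" where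
  "mean N M f = (\<integral>x. f x \<partial>nu N M)"

definition covar :: "nat \<Rightarrow> nat \<Rightarrow> (real \<times> real \<Rightarrow> real) \<Rightarrow> (real \<times> real \<Rightarrow> real) \<Rightarrow> real" where
  "covar N M f g = (\<integral>x. (f x - mean N M f) * (g x - mean N M g) \<partial>nu N M)"

(* Meaningful for non-negative square-integrable f and g; no hypothesis of this kind is built in. *)
definition cSSIM ::
  "real \<Rightarrow> real \<Rightarrow> nat \<Rightarrow> nat \<Rightarrow> (real \<times> real \<Rightarrow> real) \<Rightarrow> (real \<times> real \<Rightarrow> real) \<Rightarrow> real" where
  "cSSIM c1 c2 N M f g =
     (2 * mean N M f * mean N M g + c1) / ((mean N M f)\<^sup>2 + (mean N M g)\<^sup>2 + c1) *
     ((2 * covar N M f g + c2) / (covar N M f f + covar N M g g + c2))"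

end

theory Submission
  imports Defs "HOL-Probability.Probability_Measure"
begin

text \<open>
  Write \<open>g\<close> for the network approximation of the image \<open>f\<close>. Both factors of the cSSIM deviate
  from 1 by a quotient whose numerator is at most the mean square error: with \<open>P\<close> and \<open>Q\<close> the
  two denominators, \<open>1 - l = (\<mu>\<^sub>f - \<mu>\<^sub>g)\<^sup>2 / P\<close> for the luminance factor \<open>l\<close> and
  \<open>1 - s = Var (f - g) / Q\<close> for the structure factor \<open>s\<close>. As \<open>f\<close> and \<open>g\<close> take values in
  \<open>[0, 255]\<close>, the mean square error is at most 255 times the \<open>L\<^sup>1\<close> error, so the theorem reduces to
  an \<open>L\<^sup>1\<close> estimate (\<open>one_minus_SSIM_le\<close>).

  At a point \<open>x\<close>, the value \<open>g x\<close> is a weighted average of samples \<open>f (k / n)\<close>, and only samples from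
  other pixels contribute to the error. The kernel is a product and so is the grid, hence the
  relative weight of those samples is at most the sum of two one-dimensional ones, one per
  coordinate. In one dimension the kernel \<open>phi \<sigma>\<close> is a difference of two shifts of \<open>\<sigma>\<close>, so a sum of
  its integer translates telescopes: the total weight is at least \<open>\<sigma> 1 - 1 / 2 > 0\<close>, and the weight
  beyond a pixel edge at distance \<open>d\<close> from the evaluation point is at most \<open>\<sigma> (1 - n * d)\<close>. By the
  decay of \<open>\<sigma>\<close> at minus infinity this is at most \<open>C / (1 + (n * d)\<^sup>2)\<close>.

  The pointwise error is thus dominated by a sum of such bumps centred at the pixel edges
  (\<open>NN_op_pointwise_error\<close>). Each bump has the primitive \<open>arctan (n * d) / n\<close>, so its integral is
  at most \<open>pi / n\<close>. The \<open>L\<^sup>1\<close> error is therefore of order \<open>1 / n\<close>, and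
  \<open>1 / n \<le> 1 / n powr \<theta>\<close>.
\<close>

section \<open>Symmetric sigmoids and sums of translates of the kernel\<close>

locale odd_sigmoid =
  fixes \<sigma> :: "real \<Rightarrow> real"
  assumes sig: "sigmoidal \<sigma>" and mono: "mono \<sigma>" and reflect: "\<sigma> (- x) = 1 - \<sigma> x"
begin

lemma unit_range: "0 \<le> \<sigma> x" "\<sigma> x \<le> 1"
proof -
  show le: "\<sigma> x \<le> 1" for x
    by (rule tendsto_lowerbound[of \<sigma> 1 at_top])
      (use sig mono in \<open>auto simp: sigmoidal_def mono_def eventually_at_top_linorder\<close>)
  show "0 \<le> \<sigma> x"
    using le[of "- x"] reflect[of x] by simp
qed

lemma phi_nonneg: "0 \<le> phi \<sigma> x"
  using mono by (simp add: phi_def mono_def)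

text \<open>The step \<open>k \<rightarrow> k + 1\<close> moves the argument by 1 while the two shifts in the kernel differ
  by 2; two values of \<open>\<sigma>\<close> therefore survive at each end.\<close>

lemma sum_phi_telescope:
  assumes "a \<le> b"
  shows "(\<Sum>k\<in>{a..b::int}. phi \<sigma> (u - of_int k))
    = (\<sigma> (u - of_int a + 1) + \<sigma> (u - of_int a) - \<sigma> (u - of_int b) - \<sigma> (u - of_int b - 1)) / 2"
  using assms
proof (induction b rule: int_ge_induct)
  case base
  then show ?case by (simp add: phi_def algebra_simps)
next
  case (step b)
  have "{a..b + 1} = insert (b + 1) {a..b}"
    using step by auto
  then show ?case
    using step by (simp add: phi_def algebra_simps add_divide_distrib diff_divide_distrib)
qed

text \<open>Both tail bounds are in terms of the signed distance from \<open>u\<close> to the nearest summation index and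
  independent of the far end of the range, so that edges to the right and to the left of \<open>u\<close> can be
  treated alike.\<close>

lemma sum_phi_right_tail: "(\<Sum>k\<in>{a..b::int}. phi \<sigma> (u - of_int k)) \<le> \<sigma> (1 - (of_int a - u))"
proof (cases "a \<le> b")
  case True
  have "\<sigma> (u - of_int a) \<le> \<sigma> (u - of_int a + 1)"
    using mono by (simp add: mono_def)
  moreover note unit_range[of "u - of_int b"] unit_range[of "u - of_int b - 1"]
  moreover have "\<sigma> (1 - (of_int a - u)) = \<sigma> (u - of_int a + 1)"
    by (rule arg_cong[of _ _ \<sigma>]) simp
  ultimately show ?thesis
    unfolding sum_phi_telescope[OF True] by simp
qed (simp add: unit_range)

lemma sum_phi_left_tail: "(\<Sum>k\<in>{a..b::int}. phi \<sigma> (u - of_int k)) \<le> \<sigma> (1 - (u - of_int b))"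
proof (cases "a \<le> b")
  case True
  have "\<sigma> (u - of_int b - 1) \<le> \<sigma> (u - of_int b)"
    using mono by (simp add: mono_def)
  moreover note unit_range[of "u - of_int a"] unit_range[of "u - of_int a + 1"]
  moreover have "\<sigma> (1 - (u - of_int b)) = 1 - \<sigma> (u - of_int b - 1)"
    using reflect[of "u - of_int b - 1"] by simp
  ultimately show ?thesis
    unfolding sum_phi_telescope[OF True] by simp
qed (simp add: unit_range)

lemma sum_phi_lower_bound:
  assumes "of_int a \<le> u" "u \<le> of_int b"
  shows "\<sigma> 1 - 1 / 2 \<le> (\<Sum>k\<in>{a..b::int}. phi \<sigma> (u - of_int k))"
proof -
  have ab: "a \<le> b"
    using assms by linarith
  have half: "\<sigma> 0 = 1 / 2"
    using reflect[of 0] by simp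
  have "\<sigma> 1 \<le> \<sigma> (u - of_int a + 1)" "\<sigma> 0 \<le> \<sigma> (u - of_int a)"
      "\<sigma> (u - of_int b) \<le> \<sigma> 0" "\<sigma> (u - of_int b - 1) \<le> \<sigma> (- 1)"
    using mono assms by (auto simp: mono_def)
  then show ?thesis
    unfolding sum_phi_telescope[OF ab] using reflect[of 1] half by simp
qed

text \<open>If \<open>\<sigma> 1 = \<sigma> 0 = 1 / 2\<close>, concavity would keep \<open>\<sigma> \<le> 1 / 2\<close> on the whole half line,
  against its limit 1. Quantitatively, 1 is the convex combination of 0 and a point \<open>x\<close> with
  \<open>\<sigma> x > 3 / 4\<close>.\<close>

lemma half_less_if_concave:
  assumes "concave_on {0..} \<sigma>"
  shows "1 / 2 < \<sigma> 1"
proof -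
  have half: "\<sigma> 0 = 1 / 2"
    using reflect[of 0] by simp
  have "eventually (\<lambda>x. \<sigma> x > 3 / 4) at_top"
    using sig order_tendstoD(1)[of \<sigma> 1 at_top "3 / 4"] by (simp add: sigmoidal_def)
  then have "eventually (\<lambda>x. \<sigma> x > 3 / 4 \<and> x \<ge> 1) at_top"
    by (intro eventually_conj eventually_ge_at_top)
  then obtain x where x: "\<sigma> x > 3 / 4" "x \<ge> 1"
    by (auto dest: eventually_happens)
  have "(1 - 1 / x) * \<sigma> 0 + (1 / x) * \<sigma> x \<le> \<sigma> ((1 - 1 / x) *\<^sub>R 0 + (1 / x) *\<^sub>R x)"
    using assms x by (intro concave_onD[OF assms]) auto
  then have "(1 - 1 / x) / 2 + (1 / x) * \<sigma> x \<le> \<sigma> 1"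
    using x half by simp
  moreover have "(1 / x) * (3 / 4) < (1 / x) * \<sigma> x"
    using x by (intro mult_strict_left_mono) auto
  moreover have "(1 - 1 / x) / 2 + (1 / x) * (3 / 4) = 1 / 2 + 1 / (4 * x)" "1 / (4 * x) > 0"
    using x by (simp_all add: field_simps)
  ultimately show ?thesis by linarith
qed

text \<open>Decay of order \<open>-1 - \<alpha> \<le> -2\<close> is replaced by the weight \<open>1 / (1 + t\<^sup>2)\<close>, which needs no case
  distinction near 0 and has an elementary primitive. Where the asymptotic bound is not yet valid,
  \<open>\<sigma> \<le> 1\<close> and the weight is bounded below.\<close>

lemma quadratic_tail_bound:
  assumes O: "\<sigma> \<in> O[at_bot](\<lambda>x. \<bar>x\<bar> powr (- 1 - \<alpha>))" and "\<alpha> \<ge> 1"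
  shows "\<exists>C>0. \<forall>t\<ge>0. \<sigma> (1 - t) \<le> C / (1 + t\<^sup>2)"
proof -
  obtain c where c: "c > 0" "eventually (\<lambda>x. norm (\<sigma> x) \<le> c * norm (\<bar>x\<bar> powr (- 1 - \<alpha>))) at_bot"
    using landau_o.bigE[OF O] by blast
  then obtain L0 where L0: "\<And>x. x \<le> L0 \<Longrightarrow> \<bar>\<sigma> x\<bar> \<le> c * \<bar>x\<bar> powr (- 1 - \<alpha>)"
    by (auto simp: eventually_at_bot_linorder)
  define L where "L = min L0 (- 1)"
  \<comment> \<open>The first summand serves \<open>1 - t \<le> L\<close>, where \<open>1 + t\<^sup>2 \<le> 5 * (t - 1)\<^sup>2\<close> as \<open>t - 1 \<ge> 1\<close>;
    the second serves the bounded range \<open>t < 1 - L\<close>.\<close>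
  define C where "C = 5 * c + (1 + (1 - L)\<^sup>2)"
  have "\<sigma> (1 - t) \<le> C / (1 + t\<^sup>2)" if "t \<ge> 0" for t
  proof -
    have pos: "1 + t\<^sup>2 > 0"
      by (simp add: add_pos_nonneg)
    have "\<sigma> (1 - t) * (1 + t\<^sup>2) \<le> C"
    proof (cases "1 - t \<le> L")
      case True
      define s where "s = t - 1"
      have s: "s \<ge> 1" "\<bar>1 - t\<bar> = s" "t = s + 1"
        using True by (auto simp: L_def s_def)
      have "\<sigma> (1 - t) \<le> c * s powr (- 1 - \<alpha>)"
        using L0[of "1 - t"] True s by (auto simp: L_def)
      also have "\<dots> \<le> c * s powr (- 2)"
        using c s assms by (intro mult_left_mono powr_mono) auto
      also have "s powr (- 2) = 1 / s\<^sup>2"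
        using s by (simp add: powr_minus divide_inverse)
      finally have "\<sigma> (1 - t) * (1 + t\<^sup>2) \<le> c * (1 / s\<^sup>2) * (1 + t\<^sup>2)"
        using pos by (intro mult_right_mono) auto
      also have "\<dots> = c * ((1 + t\<^sup>2) / s\<^sup>2)"
        by simp
      also have "(1 + t\<^sup>2) / s\<^sup>2 \<le> 5"
      proof -
        have "s * 1 \<le> s * s"
          using s by (intro mult_left_mono) auto
        then have "1 + t\<^sup>2 \<le> 5 * s\<^sup>2"
          unfolding s(3) using s(1) unfolding power2_eq_square ring_distribs by linarith
        then show ?thesis
          using s by (simp add: divide_le_eq)
      qed
      finally have "\<sigma> (1 - t) * (1 + t\<^sup>2) \<le> 5 * c"
        using c by simp
      then show ?thesis
        unfolding C_def using zero_le_power2[of "1 - L"] by linarith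
    next
      case False
      have "\<sigma> (1 - t) * (1 + t\<^sup>2) \<le> 1 * (1 + t\<^sup>2)"
        using pos unit_range by (intro mult_right_mono) auto
      also have "\<dots> \<le> 1 + (1 - L)\<^sup>2"
        using False that by (simp add: power_mono)
      finally show ?thesis
        using c by (simp add: C_def)
    qed
    then show ?thesis
      using pos by (simp add: pos_le_divide_eq)
  qed
  moreover have "C > 0"
    using c by (simp add: C_def add_pos_nonneg)
  ultimately show ?thesis by blast
qed

end

section \<open>Pixels\<close>

lemma pixel_side_cover:
  assumes "0 \<le> t" "t \<le> real N" "N > 0"
  shows "\<exists>i\<in>{1..N}. t \<in> pixel_side N i"
proof (cases "t = real N")
  case True
  then show ?thesis
    using assms by (intro bexI[of _ N]) (auto simp: pixel_side_def)
next
  case False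
  define i where "i = nat \<lfloor>t\<rfloor> + 1"
  have i: "real i - 1 \<le> t" "t < real i"
    using assms real_of_int_floor_add_one_gt[of t] by (auto simp: i_def add.commute)
  have "i \<le> N"
    using i False assms by linarith
  then show ?thesis
    using i by (intro bexI[of _ i]) (auto simp: pixel_side_def i_def)
qed

lemma pixel_side_unique:
  assumes "t \<in> pixel_side N i" "t \<in> pixel_side N i'" "i \<le> N" "i' \<le> N"
  shows "i = i'"
proof -
  consider "i < i'" | "i' < i" | "i = i'" by linarith
  then show ?thesis
  proof cases
    case 1
    then have "real i + 1 \<le> real i'" by simp
    with 1 assms show ?thesis by (auto simp: pixel_side_def split: if_splits)
  next
    case 2
    then have "real i' + 1 \<le> real i" by simp
    with 2 assms show ?thesis by (auto simp: pixel_side_def split: if_splits)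
  qed
qed

text \<open>The pixels are disjoint, so the double sum has a single nonzero term at each point.\<close>

lemma digital_image_on_pixels:
  assumes "digital_image N M f"
  obtains F :: "nat \<Rightarrow> nat \<Rightarrow> real"
  where "\<And>i j. i \<in> {1..N} \<Longrightarrow> j \<in> {1..M} \<Longrightarrow> 0 \<le> F i j \<and> F i j \<le> 255"
    and "\<And>i j x. i \<in> {1..N} \<Longrightarrow> j \<in> {1..M} \<Longrightarrow> x \<in> pixel N M i j \<Longrightarrow> x \<in> image_domain N M
        \<Longrightarrow> f x = F i j"
proof -
  obtain F :: "nat \<Rightarrow> nat \<Rightarrow> nat" where
    F: "\<And>i j. i \<in> {1..N} \<Longrightarrow> j \<in> {1..M} \<Longrightarrow> F i j \<in> {0..255}"
    and f: "\<And>x. x \<in> image_domain N M \<Longrightarrow>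
      f x = (\<Sum>i=1..N. \<Sum>j=1..M. real (F i j) * indicator (pixel N M i j) x)"
    using assms unfolding digital_image_def by blast
  show thesis
  proof
    show "0 \<le> real (F i j) \<and> real (F i j) \<le> 255" if "i \<in> {1..N}" "j \<in> {1..M}" for i j
      using F[OF that] by simp
    fix i j x
    assume ij: "i \<in> {1..N}" "j \<in> {1..M}" and x: "x \<in> pixel N M i j" "x \<in> image_domain N M"
    have ind: "indicator (pixel N M i' j') x = (if i' = i then if j' = j then 1 else 0 else (0::real))"
      if "i' \<in> {1..N}" "j' \<in> {1..M}" for i' j'
      using pixel_side_unique x ij that by (fastforce simp: pixel_def indicator_def)
    have "f x = (\<Sum>i'=1..N. \<Sum>j'=1..M. if i' = i then if j' = j then real (F i' j') else 0 else 0)"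
      unfolding f[OF x(2)] by (intro sum.cong refl) (simp add: ind)
    also have "\<dots> = (\<Sum>i'=1..N. if i' = i then \<Sum>j'=1..M. if j' = j then real (F i' j') else 0 else 0)"
      by (intro sum.cong refl) simp
    also have "\<dots> = real (F i j)"
      using ij by simp
    finally show "f x = real (F i j)" .
  qed
qed

lemma digital_image_range:
  assumes "digital_image N M f" "N > 0" "M > 0" "x \<in> image_domain N M"
  shows "0 \<le> f x \<and> f x \<le> 255"
proof -
  obtain i j where "i \<in> {1..N}" "fst x \<in> pixel_side N i" "j \<in> {1..M}" "snd x \<in> pixel_side M j"
    using pixel_side_cover[of "fst x" N] pixel_side_cover[of "snd x" M] assms
    by (auto simp: image_domain_def)
  then show ?thesis
    using digital_image_on_pixels[OF assms(1)] assms(4)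
    by (metis mem_Times_iff pixel_def)
qed

lemma off_pixel_cases:
  assumes "t \<in> {0..real N}" "t \<notin> pixel_side N i" "i \<in> {1..N}"
  shows "real i \<le> t \<or> t \<le> real i - 1"
  using assms by (auto simp: pixel_side_def split: if_splits)

section \<open>Weight of the samples outside the pixel of the evaluation point\<close>

text \<open>The dominating function for the relative weight of foreign samples: Lorentzian bumps of width
  \<open>1 / n\<close> at all the edges \<open>0, \<dots>, N\<close>. Summing over all edges, instead of taking the two edges of the
  current pixel, makes it independent of the pixel and continuous.\<close>

definition edge_bumps :: "nat \<Rightarrow> nat \<Rightarrow> real \<Rightarrow> real" where
  "edge_bumps N n t = (\<Sum>i=0..N. 1 / (1 + (real n * (t - real i))\<^sup>2))"

lemma edge_bumps_nonneg: "0 \<le> edge_bumps N n t"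
  unfolding edge_bumps_def by (intro sum_nonneg) (simp add: add_nonneg_nonneg)

lemma edge_bumps_le: "edge_bumps N n t \<le> real (N + 1)"
proof -
  have "edge_bumps N n t \<le> (\<Sum>i=0..N. 1)"
    unfolding edge_bumps_def by (intro sum_mono) (simp add: add_pos_nonneg)
  then show ?thesis by simp
qed

lemma continuous_on_edge_bumps: "continuous_on S (edge_bumps N n)"
  unfolding edge_bumps_def by (intro continuous_intros) (simp add: add_pos_nonneg less_imp_neq[symmetric])

lemma borel_measurable_edge_bumps: "(\<lambda>x. edge_bumps N n (fst x) + edge_bumps M n (snd x)) \<in> borel_measurable borel"
  by (intro borel_measurable_continuous_onI continuous_intros continuous_on_compose2[OF continuous_on_edge_bumps]) auto

text \<open>The sample indices outside pixel \<open>i\<close> lie at or beyond \<open>n * i\<close>, or at or below \<open>n * (i - 1)\<close>. The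
  tail bounds apply to these two ranges, and give the bumps at the edges \<open>i\<close> and \<open>i - 1\<close>.\<close>

lemma (in odd_sigmoid) off_pixel_mass:
  assumes C: "C > 0" "\<And>t. t \<ge> 0 \<Longrightarrow> \<sigma> (1 - t) \<le> C / (1 + t\<^sup>2)"
    and i: "i \<in> {1..N}" and t: "t \<in> pixel_side N i" and n: "n > 0"
  shows "(\<Sum>k\<in>{0..int (n * N)}. of_bool (of_int k / real n \<notin> pixel_side N i) * phi \<sigma> (real n * t - of_int k))
    \<le> C * edge_bumps N n t"
proof -
  let ?\<phi> = "\<lambda>k::int. phi \<sigma> (real n * t - of_int k)"
  let ?R = "{int (n * i)..int (n * N)}" and ?L = "{0..int (n * (i - 1))}"
  have ti: "real i - 1 \<le> t" "t \<le> real i"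
    using t by (auto simp: pixel_side_def split: if_splits)
  have i1: "real (i - 1) = real i - 1"
    using i by simp
  have off: "k \<in> ?R \<or> k \<in> ?L"
    if k: "k \<in> {0..int (n * N)}" "of_int k / real n \<notin> pixel_side N i" for k :: int
  proof -
    have "real_of_int k \<le> real_of_int (int (n * N))"
      using k(1) by (simp only: of_int_le_iff atLeastAtMost_iff)
    then have "of_int k / real n \<in> {0..real N}"
      using k(1) n by (simp add: divide_le_eq mult.commute)
    from off_pixel_cases[OF this k(2) i] show ?thesis
    proof
      assume "real i \<le> of_int k / real n"
      then have "real_of_int (int (n * i)) \<le> real_of_int k"
        using n by (simp add: le_divide_eq mult.commute)
      then show ?thesis
        using k(1) by (simp only: of_int_le_iff) auto
    next
      assume "of_int k / real n \<le> real i - 1"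
      then have "real_of_int k \<le> real n * (real i - 1)"
        using n by (simp add: divide_le_eq mult.commute)
      then have "real_of_int k \<le> real_of_int (int (n * (i - 1)))"
        by (simp only: of_int_of_nat_eq of_nat_mult of_int_mult i1)
      then show ?thesis
        using k(1) by (simp only: of_int_le_iff) auto
    qed
  qed
  have "(\<Sum>k\<in>{0..int (n * N)}. of_bool (of_int k / real n \<notin> pixel_side N i) * ?\<phi> k)
      = (\<Sum>k | k \<in> {0..int (n * N)} \<and> of_int k / real n \<notin> pixel_side N i. ?\<phi> k)"
    by (rule sum.mono_neutral_cong_right) auto
  also have "\<dots> \<le> sum ?\<phi> (?R \<union> ?L)"
  proof (rule sum_mono2)
    show "{k \<in> {0..int (n * N)}. of_int k / real n \<notin> pixel_side N i} \<subseteq> ?R \<union> ?L"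
      using off by blast
  qed (auto simp: phi_nonneg)
  also have "\<dots> \<le> sum ?\<phi> ?R + sum ?\<phi> ?L"
    by (subst sum_Un) (auto intro!: sum_nonneg simp: phi_nonneg)
  also have "\<dots> \<le> \<sigma> (1 - (of_int (int (n * i)) - real n * t)) + \<sigma> (1 - (real n * t - of_int (int (n * (i - 1)))))"
    by (intro add_mono sum_phi_right_tail sum_phi_left_tail)
  also have "\<dots> = \<sigma> (1 - real n * (real i - t)) + \<sigma> (1 - real n * (t - real (i - 1)))"
    by (simp add: right_diff_distrib)
  also have "\<dots> \<le> C / (1 + (real n * (real i - t))\<^sup>2) + C / (1 + (real n * (t - real (i - 1)))\<^sup>2)"
    using ti i1 by (intro add_mono C(2)) auto
  also have "\<dots> = C * (\<Sum>j\<in>{i - 1, i}. 1 / (1 + (real n * (t - real j))\<^sup>2))"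
  proof -
    have "i - 1 \<noteq> i"
      using i by auto
    then show ?thesis
      by (simp add: power_mult_distrib power2_commute[of "real i"] distrib_left)
  qed
  also have "\<dots> \<le> C * edge_bumps N n t"
    unfolding edge_bumps_def using C(1) i
    by (intro mult_left_mono sum_mono2) (auto simp: add_nonneg_nonneg)
  finally show ?thesis .
qed

text \<open>Each bump is the derivative of a rescaled arctangent, whose total variation is at most
  \<open>pi / n\<close>.\<close>

lemma integral_edge_bumps_le:
  assumes "n > 0"
  shows "integral {0..real N} (edge_bumps N n) \<le> (real N + 1) * pi / real n"
proof -
  define G where "G t = (\<Sum>i=0..N. arctan (real n * (t - real i)) / real n)" for t
  have "(G has_real_derivative edge_bumps N n t) (at t)" for t
    unfolding G_def edge_bumps_def using assms
    by (auto intro!: derivative_eq_intros sum.cong simp: inverse_eq_divide)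
  then have "(edge_bumps N n has_integral (G (real N) - G 0)) {0..real N}"
    by (intro fundamental_theorem_of_calculus)
      (auto simp flip: has_real_derivative_iff_has_vector_derivative intro: DERIV_subset)
  then have "integral {0..real N} (edge_bumps N n) = G (real N) - G 0"
    by (rule integral_unique)
  also have "\<dots> = (\<Sum>i=0..N. (arctan (real n * (real N - real i)) - arctan (real n * (0 - real i))) / real n)"
    by (simp add: G_def diff_divide_distrib sum_subtractf)
  also have "\<dots> \<le> (\<Sum>i=0..N. pi / real n)"
  proof (intro sum_mono divide_right_mono)
    show "arctan u - arctan v \<le> pi" for u v
      using arctan_bounded[of u] arctan_bounded[of v] by linarith
  qed simp
  also have "\<dots> = (real N + 1) * pi / real n"
    by simp
  finally show ?thesis .
qed

section \<open>Pointwise error of the network operators\<close>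

lemma grid_eq: "grid N M n = {0..int (n * N)} \<times> {0..int (n * M)}"
  by (auto simp: grid_def)

lemma (in odd_sigmoid) NN_op_denominator:
  "(\<Sum>k\<in>grid N M n. Psi \<sigma> (real n *\<^sub>R x - int_vec k))
    = (\<Sum>k\<in>{0..int (n * N)}. phi \<sigma> (real n * fst x - of_int k))
      * (\<Sum>k\<in>{0..int (n * M)}. phi \<sigma> (real n * snd x - of_int k))"
  by (simp add: grid_eq Psi_def int_vec_def sum_product sum.cartesian_product case_prod_beta)

lemma (in odd_sigmoid) denominator_ge:
  assumes "n > 0" "x \<in> image_domain N M"
  shows "\<sigma> 1 - 1 / 2 \<le> (\<Sum>k\<in>{0..int (n * N)}. phi \<sigma> (real n * fst x - of_int k))"
    and "\<sigma> 1 - 1 / 2 \<le> (\<Sum>k\<in>{0..int (n * M)}. phi \<sigma> (real n * snd x - of_int k))"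
  using assms by (auto intro!: sum_phi_lower_bound simp: image_domain_def mem_Times_iff)

lemma grid_point_in_domain:
  assumes "n > 0" "k \<in> grid N M n"
  shows "int_vec k /\<^sub>R real n \<in> image_domain N M"
proof -
  have "real_of_int (fst k) \<le> real_of_int (int (n * N))" "real_of_int (snd k) \<le> real_of_int (int (n * M))"
    using assms(2) unfolding grid_def of_int_le_iff by auto
  then show ?thesis
    using assms by (auto simp: image_domain_def int_vec_def grid_def field_simps)
qed

lemma (in odd_sigmoid) NN_op_bounds:
  assumes "n > 0" and "x \<in> image_domain N M" and "1 / 2 < \<sigma> 1"
    and f: "\<And>y. y \<in> image_domain N M \<Longrightarrow> 0 \<le> f y \<and> f y \<le> B"
  shows "0 \<le> NN_op \<sigma> N M n f x \<and> NN_op \<sigma> N M n f x \<le> B"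
proof -
  let ?\<Psi> = "\<lambda>k. Psi \<sigma> (real n *\<^sub>R x - int_vec k)"
  have \<Psi>: "0 \<le> ?\<Psi> k" for k
    by (simp add: Psi_def phi_nonneg)
  have "0 < (\<Sum>k\<in>grid N M n. ?\<Psi> k)"
    using denominator_ge[OF assms(1,2)] assms(3) unfolding NN_op_denominator
    by (intro mult_pos_pos) linarith+
  moreover have "0 \<le> (\<Sum>k\<in>grid N M n. f (int_vec k /\<^sub>R real n) * ?\<Psi> k)"
    using f[OF grid_point_in_domain[OF assms(1)]] \<Psi> by (intro sum_nonneg mult_nonneg_nonneg) auto
  moreover have "(\<Sum>k\<in>grid N M n. f (int_vec k /\<^sub>R real n) * ?\<Psi> k) \<le> (\<Sum>k\<in>grid N M n. B * ?\<Psi> k)"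
    using f[OF grid_point_in_domain[OF assms(1)]] \<Psi> by (intro sum_mono mult_right_mono) auto
  ultimately show ?thesis
    by (simp add: NN_op_def divide_le_eq sum_distrib_left)
qed

text \<open>A sample \<open>f (k / n)\<close> differs from \<open>f x\<close> only if \<open>k / n\<close> leaves the pixel of \<open>x\<close> in its first or
  in its second coordinate. A union bound over the two events separates the variables: after
  division by the product of the one-dimensional total weights, the full weight of the other
  coordinate cancels.\<close>

lemma (in odd_sigmoid) NN_op_pointwise_error:
  assumes C: "C > 0" "\<And>t. t \<ge> 0 \<Longrightarrow> \<sigma> (1 - t) \<le> C / (1 + t\<^sup>2)"
    and half: "1 / 2 < \<sigma> 1" and f: "digital_image N M f"
    and pos: "N > 0" "M > 0" "n > 0" and x: "x \<in> image_domain N M"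
  shows "\<bar>f x - NN_op \<sigma> N M n f x\<bar> \<le> 255 * (C / (\<sigma> 1 - 1 / 2)) * (edge_bumps N n (fst x) + edge_bumps M n (snd x))"
proof -
  obtain F :: "nat \<Rightarrow> nat \<Rightarrow> real" where
    F: "\<And>i j. i \<in> {1..N} \<Longrightarrow> j \<in> {1..M} \<Longrightarrow> 0 \<le> F i j \<and> F i j \<le> 255"
    and fF: "\<And>i j x. i \<in> {1..N} \<Longrightarrow> j \<in> {1..M} \<Longrightarrow> x \<in> pixel N M i j \<Longrightarrow> x \<in> image_domain N M
        \<Longrightarrow> f x = F i j"
    using digital_image_on_pixels[OF f] by metis
  have f255: "0 \<le> f y \<and> f y \<le> 255" if "y \<in> image_domain N M" for y
    using digital_image_range[OF f pos(1,2) that] .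
  obtain i j where i: "i \<in> {1..N}" "fst x \<in> pixel_side N i" and j: "j \<in> {1..M}" "snd x \<in> pixel_side M j"
    using pixel_side_cover[of "fst x" N] pixel_side_cover[of "snd x" M] pos x
    by (auto simp: image_domain_def)
  let ?\<phi>1 = "\<lambda>k::int. phi \<sigma> (real n * fst x - of_int k)" and ?\<phi>2 = "\<lambda>k::int. phi \<sigma> (real n * snd x - of_int k)"
  let ?\<Psi> = "\<lambda>k. Psi \<sigma> (real n *\<^sub>R x - int_vec k)"
  let ?A = "{0..int (n * N)}" and ?B = "{0..int (n * M)}"
  \<comment> \<open>\<open>b1\<close> and \<open>b2\<close> mark the indices that leave the pixel in the respective coordinate.\<close>
  define b1 :: "int \<Rightarrow> real" where "b1 k = of_bool (of_int k / real n \<notin> pixel_side N i)" for k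
  define b2 :: "int \<Rightarrow> real" where "b2 k = of_bool (of_int k / real n \<notin> pixel_side M j)" for k
  define D where "D = \<sigma> 1 - 1 / 2"
  define W1 where "W1 = (\<Sum>k\<in>?A. ?\<phi>1 k)"
  define W2 where "W2 = (\<Sum>k\<in>?B. ?\<phi>2 k)"
  define S1 where "S1 = (\<Sum>k\<in>?A. b1 k * ?\<phi>1 k)"
  define S2 where "S2 = (\<Sum>k\<in>?B. b2 k * ?\<phi>2 k)"
  have D: "D > 0" "D \<le> W1" "D \<le> W2"
    using denominator_ge[OF pos(3) x] half by (auto simp: D_def W1_def W2_def)
  have S1: "S1 \<le> C * edge_bumps N n (fst x)"
    unfolding S1_def b1_def using off_pixel_mass[OF C i pos(3)] by simp
  have S2: "S2 \<le> C * edge_bumps M n (snd x)"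
    unfolding S2_def b2_def using off_pixel_mass[OF C j pos(3)] by simp
  have W: "(\<Sum>k\<in>grid N M n. ?\<Psi> k) = W1 * W2"
    by (simp add: NN_op_denominator W1_def W2_def)
  have W_pos: "W1 * W2 > 0"
    using D by simp
  have diff: "\<bar>f x - f (int_vec k /\<^sub>R real n)\<bar> \<le> 255 * (b1 (fst k) + b2 (snd k))" if k: "k \<in> grid N M n" for k
  proof -
    have dom: "int_vec k /\<^sub>R real n \<in> image_domain N M"
      by (rule grid_point_in_domain[OF pos(3) k])
    show ?thesis
    proof (cases "b1 (fst k) = 0 \<and> b2 (snd k) = 0")
      case True
      then have "int_vec k /\<^sub>R real n \<in> pixel N M i j"
        by (simp add: b1_def b2_def pixel_def int_vec_def mem_Times_iff divide_inverse mult.commute)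
      moreover have "x \<in> pixel N M i j"
        using i j by (simp add: pixel_def mem_Times_iff)
      ultimately show ?thesis
        using fF[OF i(1) j(1)] x dom True by simp
    next
      case False
      then have "255 * 1 \<le> 255 * (b1 (fst k) + b2 (snd k))"
        by (intro mult_left_mono) (auto simp: b1_def b2_def)
      moreover have "\<bar>f x - f (int_vec k /\<^sub>R real n)\<bar> \<le> 255"
        using f255[OF x] f255[OF dom] by linarith
      ultimately show ?thesis by simp
    qed
  qed
  have "f x - NN_op \<sigma> N M n f x = (\<Sum>k\<in>grid N M n. (f x - f (int_vec k /\<^sub>R real n)) * ?\<Psi> k) / (W1 * W2)"
    using D unfolding NN_op_def
    by (simp add: W left_diff_distrib sum_subtractf flip: sum_distrib_left) (simp add: W diff_divide_distrib)
  also have "\<bar>\<dots>\<bar> = \<bar>\<Sum>k\<in>grid N M n. (f x - f (int_vec k /\<^sub>R real n)) * ?\<Psi> k\<bar> / (W1 * W2)"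
    using W_pos by (simp add: abs_divide)
  also have "\<dots> \<le> (255 * (S1 * W2 + W1 * S2)) / (W1 * W2)"
  proof (intro divide_right_mono)
    have "\<bar>\<Sum>k\<in>grid N M n. (f x - f (int_vec k /\<^sub>R real n)) * ?\<Psi> k\<bar>
        \<le> (\<Sum>k\<in>grid N M n. \<bar>(f x - f (int_vec k /\<^sub>R real n)) * ?\<Psi> k\<bar>)"
      by (rule sum_abs)
    also have "\<dots> \<le> (\<Sum>k\<in>grid N M n. 255 * (b1 (fst k) + b2 (snd k)) * ?\<Psi> k)"
      using diff by (intro sum_mono) (auto simp: abs_mult Psi_def phi_nonneg intro!: mult_right_mono)
    also have "\<dots> = 255 * ((\<Sum>k\<in>?A \<times> ?B. (b1 (fst k) * ?\<phi>1 (fst k)) * ?\<phi>2 (snd k))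
        + (\<Sum>k\<in>?A \<times> ?B. ?\<phi>1 (fst k) * (b2 (snd k) * ?\<phi>2 (snd k))))"
      by (simp add: grid_eq Psi_def int_vec_def sum_distrib_left algebra_simps flip: sum.distrib)
    also have "\<dots> = 255 * (S1 * W2 + W1 * S2)"
      by (simp only: S1_def S2_def W1_def W2_def sum_product sum.cartesian_product case_prod_unfold)
    finally show "\<bar>\<Sum>k\<in>grid N M n. (f x - f (int_vec k /\<^sub>R real n)) * ?\<Psi> k\<bar> \<le> 255 * (S1 * W2 + W1 * S2)" .
  qed (use W_pos in simp)
  also have "\<dots> = 255 * (S1 / W1 + S2 / W2)"
    using D by (simp add: field_simps)
  also have "\<dots> \<le> 255 * (C * edge_bumps N n (fst x) / D + C * edge_bumps M n (snd x) / D)"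
    using S1 S2 D C(1) by (intro mult_left_mono add_mono frac_le) (auto simp: edge_bumps_nonneg)
  also have "\<dots> = 255 * (C / D) * (edge_bumps N n (fst x) + edge_bumps M n (snd x))"
    by (simp add: algebra_simps add_divide_distrib)
  finally show ?thesis
    unfolding D_def .
qed

lemma (in odd_sigmoid) borel_measurable_NN_op: "NN_op \<sigma> N M n f \<in> borel_measurable borel"
proof -
  have \<sigma>_comp: "(\<lambda>x. \<sigma> (u x)) \<in> borel_measurable borel" if "continuous_on UNIV u"
    for u :: "real \<times> real \<Rightarrow> real"
    by (rule measurable_compose[OF borel_measurable_continuous_onI[OF that] borel_measurable_mono[OF mono]])
  show ?thesis
    unfolding NN_op_def[abs_def] Psi_def phi_def
    by (intro borel_measurable_divide borel_measurable_sum borel_measurable_times borel_measurable_diff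
        borel_measurable_const \<sigma>_comp continuous_intros)
qed

section \<open>Integration over the image domain\<close>

lemma space_nu: "space (nu N M) = image_domain N M"
  by (simp add: nu_def)

lemma image_domain_cbox: "image_domain N M = cbox (0, 0) (real N, real M)"
  by (simp add: image_domain_def cbox_Pair_eq)

lemma emeasure_image_domain:
  "emeasure (lebesgue_on (image_domain N M)) (image_domain N M) = ennreal (real N * real M)"
proof -
  have "emeasure (lebesgue_on (image_domain N M)) (image_domain N M) = emeasure lborel (cbox (0, 0) (real N, real M))"
    by (subst emeasure_restrict_space) (auto simp: image_domain_cbox)
  also have "\<dots> = ennreal (measure lborel (cbox (0, 0) (real N, real M)))"
    by (rule emeasure_eq_ennreal_measure) (use emeasure_lborel_cbox_finite[of "(0, 0)" "(real N, real M)"] in \<open>simp add: less_top\<close>)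
  also have "measure lborel (cbox (0, 0) (real N, real M)) = real N * real M"
    by (simp add: content_Pair)
  finally show ?thesis .
qed

lemma prob_space_nu:
  assumes "N > 0" "M > 0"
  shows "prob_space (nu N M)"
  unfolding nu_def
  using emeasure_image_domain[of N M] assms by (intro prob_space_uniform_measure) auto

lemma borel_measurable_nu:
  assumes "f \<in> borel_measurable borel"
  shows "f \<in> borel_measurable (nu N M)"
proof -
  have "f \<in> borel_measurable (lebesgue_on (image_domain N M))"
    using assms by (intro measurable_restrict_space1 measurable_completion) simp
  then show ?thesis
    by (simp add: nu_def)
qed

lemma integral_nu_continuous:
  fixes h :: "real \<times> real \<Rightarrow> real"
  assumes "N > 0" "M > 0" "continuous_on (image_domain N M) h"
  shows "(\<integral>x. h x \<partial>nu N M) = integral {0..real N} (\<lambda>s. integral {0..real M} (\<lambda>t. h (s, t))) / (real N * real M)"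
proof -
  let ?I = "image_domain N M" and ?c = "real N * real M"
  have int: "integrable (lebesgue_on ?I) h"
    using assms(3) unfolding image_domain_cbox by (rule continuous_imp_integrable)
  have c: "?c > 0" using assms by simp
  have "nu N M = density (lebesgue_on ?I) (\<lambda>x. ennreal (indicator ?I x / ?c))"
    unfolding nu_def uniform_measure_def emeasure_image_domain using c
    by (intro arg_cong[of _ _ "density _"] ext)
      (simp add: ennreal_divide_times divide_ennreal split: split_indicator flip: ennreal_1)
  also have "(\<integral>x. h x \<partial>\<dots>) = (\<integral>x. (indicator ?I x / ?c) *\<^sub>R h x \<partial>lebesgue_on ?I)"
  proof (rule integral_density)
    show "(\<lambda>x. indicator ?I x / ?c) \<in> borel_measurable (lebesgue_on ?I)"
      by (intro borel_measurable_divide borel_measurable_indicator) (auto simp: sets_restrict_space image_domain_cbox)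
  qed (use int in auto)
  also have "\<dots> = (\<integral>x. h x / ?c \<partial>lebesgue_on ?I)"
    by (intro Bochner_Integration.integral_cong) auto
  also have "\<dots> = integral ?I h / ?c"
    using lebesgue_integral_eq_integral[OF int] by (simp add: image_domain_cbox)
  also have "integral ?I h = integral {0..real N} (\<lambda>s. integral {0..real M} (\<lambda>t. h (s, t)))"
    using integral_prod_continuous[of 0 0 "real N" "real M" h] assms(3) by (simp add: image_domain_cbox)
  finally show ?thesis .
qed

lemma borel_measurable_digital_image:
  assumes "digital_image N M f"
  shows "f \<in> borel_measurable (nu N M)"
proof -
  obtain F :: "nat \<Rightarrow> nat \<Rightarrow> nat" where
    f: "\<And>x. x \<in> image_domain N M \<Longrightarrow>
      f x = (\<Sum>i=1..N. \<Sum>j=1..M. real (F i j) * indicator (pixel N M i j) x)"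
    using assms unfolding digital_image_def by blast
  have "pixel N M i j \<in> sets borel" for i j
    unfolding pixel_def by (intro borel_Times) (simp_all add: pixel_side_def)
  then have "(\<lambda>x. \<Sum>i=1..N. \<Sum>j=1..M. real (F i j) * indicator (pixel N M i j) x) \<in> borel_measurable (nu N M)"
    by (intro borel_measurable_nu borel_measurable_sum borel_measurable_times borel_measurable_indicator) auto
  then show ?thesis
    by (subst measurable_cong[OF f]) (auto simp: space_nu)
qed

text \<open>Averaging a function of one coordinate over the rectangle is averaging it over one side; the
  factor 4 comes from \<open>N + 1 \<le> 2 * N\<close> and \<open>M + 1 \<le> 2 * M\<close>.\<close>

lemma integral_nu_edge_bumps_le:
  assumes "N > 0" "M > 0" "n > 0"
  shows "(\<integral>x. edge_bumps N n (fst x) + edge_bumps M n (snd x) \<partial>nu N M) \<le> 4 * pi / real n"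
proof -
  have int: "edge_bumps L n integrable_on {0..real K}" for L K
    by (intro integrable_continuous_real continuous_on_edge_bumps)
  let ?J = "integral {0..real N} (edge_bumps N n)" and ?K = "integral {0..real M} (edge_bumps M n)"
  have "(\<integral>x. edge_bumps N n (fst x) + edge_bumps M n (snd x) \<partial>nu N M)
      = integral {0..real N} (\<lambda>s. integral {0..real M} (\<lambda>t. edge_bumps N n s + edge_bumps M n t)) / (real N * real M)"
    using assms by (subst integral_nu_continuous)
      (auto intro!: continuous_intros continuous_on_compose2[OF continuous_on_edge_bumps])
  also have "\<dots> = integral {0..real N} (\<lambda>s. real M * edge_bumps N n s + ?K) / (real N * real M)"
    using int by (subst integral_add) auto
  also have "integral {0..real N} (\<lambda>s. real M * edge_bumps N n s + ?K) = real M * ?J + real N * ?K"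
    by (subst integral_add) (auto intro!: integrable_continuous_real continuous_intros continuous_on_edge_bumps)
  also have "\<dots> \<le> real M * ((real N + 1) * pi / real n) + real N * ((real M + 1) * pi / real n)"
    using assms by (intro add_mono mult_left_mono integral_edge_bumps_le) auto
  also have "\<dots> \<le> real M * (2 * real N * pi / real n) + real N * (2 * real M * pi / real n)"
    using assms by (intro add_mono mult_left_mono divide_right_mono mult_right_mono) auto
  finally show ?thesis
    using assms by (simp add: divide_right_mono field_simps)
qed

section \<open>Stability of the similarity index\<close>

text \<open>The numerators of \<open>1 - l\<close> and \<open>1 - s\<close>, for the two factors \<open>l\<close> and \<open>s\<close>, are the squared bias
  and the variance of \<open>f - g\<close>. They add up to \<open>E (f - g)\<^sup>2\<close>, which therefore bounds each of them. The
  identity \<open>1 - l * s = (1 - l) + l * (1 - s)\<close> with \<open>0 \<le> l \<le> 1\<close> allows the two errors to be added.\<close>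

lemma (in prob_space) one_minus_SSIM_le:
  fixes f g :: "'a \<Rightarrow> real"
  assumes meas[measurable]: "f \<in> borel_measurable M" "g \<in> borel_measurable M"
    and bounds: "\<And>x. x \<in> space M \<Longrightarrow> 0 \<le> f x \<and> f x \<le> B" "\<And>x. x \<in> space M \<Longrightarrow> 0 \<le> g x \<and> g x \<le> B"
    and c: "c1 > 0" "c2 > 0"
  defines "cov \<equiv> \<lambda>u v. expectation (\<lambda>x. (u x - expectation u) * (v x - expectation v))"
  shows "\<bar>1 - (2 * expectation f * expectation g + c1) / ((expectation f)\<^sup>2 + (expectation g)\<^sup>2 + c1) *
      ((2 * cov f g + c2) / (cov f f + cov g g + c2))\<bar>
    \<le> (1 / (cov f f + c2) + 1 / ((expectation f)\<^sup>2 + c1)) * (B * expectation (\<lambda>x. \<bar>f x - g x\<bar>))"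
proof -
  define a b where "a = expectation f" and "b = expectation g"
  define E where "E = expectation (\<lambda>x. (f x - g x)\<^sup>2)"
  have int: "integrable M u" if "u \<in> borel_measurable M" "\<And>x. x \<in> space M \<Longrightarrow> \<bar>u x\<bar> \<le> K"
    for u :: "'a \<Rightarrow> real" and K
    using that by (intro integrable_const_bound[of _ K]) (auto intro: AE_I2)
  have f: "\<bar>f x\<bar> \<le> B" and g: "\<bar>g x\<bar> \<le> B" and d: "\<bar>f x - g x\<bar> \<le> B" if "x \<in> space M" for x
    using bounds[OF that] by auto
  have [simp]: "integrable M f" "integrable M g" "integrable M (\<lambda>x. \<bar>f x - g x\<bar>)"
    using int[of f B] int[of g B] int[of "\<lambda>x. \<bar>f x - g x\<bar>" B] f g d by auto
  have prod: "integrable M (\<lambda>x. (u x - p) * (v x - q))"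
    if "u \<in> borel_measurable M" "v \<in> borel_measurable M" and u: "\<And>x. x \<in> space M \<Longrightarrow> \<bar>u x\<bar> \<le> B"
      and v: "\<And>x. x \<in> space M \<Longrightarrow> \<bar>v x\<bar> \<le> B" for u v :: "'a \<Rightarrow> real" and p q
  proof (rule int)
    show "(\<lambda>x. (u x - p) * (v x - q)) \<in> borel_measurable M"
      using that(1,2) by measurable
    show "\<bar>(u x - p) * (v x - q)\<bar> \<le> (B + \<bar>p\<bar>) * (B + \<bar>q\<bar>)" if x: "x \<in> space M" for x
      unfolding abs_mult using u[OF x] v[OF x] by (intro mult_mono) linarith+
  qed
  have [simp]: "integrable M (\<lambda>x. (f x - p) * (f x - q))" "integrable M (\<lambda>x. (g x - p) * (g x - q))"
    "integrable M (\<lambda>x. (f x - p) * (g x - q))" for p q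
    using prod f g by (auto intro: meas)
  have d2 [simp]: "integrable M (\<lambda>x. (f x - g x)\<^sup>2)"
  proof (rule int)
    show "\<bar>(f x - g x)\<^sup>2\<bar> \<le> B\<^sup>2" if "x \<in> space M" for x
      using power_mono[OF d[OF that] abs_ge_zero, of 2] by simp
  qed measurable
  define V where "V = cov f f + cov g g - 2 * cov f g"
  have "V = expectation (\<lambda>x. (f x - a) * (f x - a) + (g x - b) * (g x - b) - 2 * ((f x - a) * (g x - b)))"
    unfolding V_def cov_def a_def b_def by simp
  also have "\<dots> = variance (\<lambda>x. f x - g x)"
    unfolding a_def b_def by (auto intro!: Bochner_Integration.integral_cong simp: power2_eq_square algebra_simps)
  finally have V_var: "V = variance (\<lambda>x. f x - g x)" .
  have V: "V = E - (a - b)\<^sup>2"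
    unfolding V_var using variance_eq[of "\<lambda>x. f x - g x"] by (simp add: E_def a_def b_def)
  have V0: "0 \<le> V"
    unfolding V_var by (rule variance_positive)
  have E: "E \<le> B * expectation (\<lambda>x. \<bar>f x - g x\<bar>)"
  proof -
    have "E \<le> expectation (\<lambda>x. B * \<bar>f x - g x\<bar>)"
      unfolding E_def
    proof (rule integral_mono)
      show "(f x - g x)\<^sup>2 \<le> B * \<bar>f x - g x\<bar>" if "x \<in> space M" for x
        using mult_right_mono[OF d[OF that], of "\<bar>f x - g x\<bar>"] by (simp add: power2_eq_square flip: abs_mult)
    qed auto
    then show ?thesis by simp
  qed
  have ab: "0 \<le> a" "0 \<le> b" and cov0: "0 \<le> cov f f" "0 \<le> cov g g"
    using bounds by (auto simp: a_def b_def cov_def intro!: Bochner_Integration.integral_nonneg)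
  define P where "P = a\<^sup>2 + b\<^sup>2 + c1"
  define Q where "Q = cov f f + cov g g + c2"
  have PQ: "0 < a\<^sup>2 + c1" "a\<^sup>2 + c1 \<le> P" "0 < cov f f + c2" "cov f f + c2 \<le> Q"
    using c cov0 by (auto simp: P_def Q_def add_nonneg_pos)
  define l where "l = (2 * a * b + c1) / P"
  define s where "s = (2 * cov f g + c2) / Q"
  have l1: "1 - l = (a - b)\<^sup>2 / P"
  proof -
    have "(a - b)\<^sup>2 = P - (2 * a * b + c1)"
      by (simp add: P_def power2_eq_square algebra_simps)
    then show ?thesis
      using PQ by (simp add: l_def diff_divide_distrib)
  qed
  have s1: "1 - s = V / Q"
    using PQ by (simp add: s_def Q_def V_def field_simps)
  have "0 \<le> l"
    using ab PQ c by (auto simp: l_def)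
  moreover have "l \<le> 1"
    using PQ l1 by (smt (verit) divide_nonneg_nonneg zero_le_power2)
  ultimately have l: "0 \<le> l" "l \<le> 1" .
  have "1 - l * s = (1 - l) + l * (1 - s)"
    by (simp add: algebra_simps)
  also have "\<bar>\<dots>\<bar> \<le> (a - b)\<^sup>2 / P + V / Q"
    unfolding l1 s1 using PQ V0 l mult_right_mono[OF l(2), of "V / Q"] by (simp add: abs_of_nonneg)
  also have "\<dots> \<le> E / (a\<^sup>2 + c1) + E / (cov f f + c2)"
    using PQ V V0 zero_le_power2[of "a - b"] by (intro add_mono frac_le) linarith+
  also have "\<dots> = (1 / (cov f f + c2) + 1 / (a\<^sup>2 + c1)) * E"
    by (simp add: distrib_right)
  also have "\<dots> \<le> (1 / (cov f f + c2) + 1 / (a\<^sup>2 + c1)) * (B * expectation (\<lambda>x. \<bar>f x - g x\<bar>))"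
    using PQ by (intro mult_left_mono E) auto
  finally show ?thesis
    unfolding l_def s_def P_def Q_def a_def b_def .
qed

section \<open>Rate of convergence in cSSIM\<close>

theorem theorem22:
  fixes \<theta> \<alpha> c1 c2 :: real and \<sigma> :: "real \<Rightarrow> real"
    and N M :: nat and f :: "real \<times> real \<Rightarrow> real"
  assumes "0 < \<theta>" and "\<theta> < 1"
    and "sigmoidal \<sigma>" and "mono \<sigma>"
    and "\<forall>x. \<sigma> (- x) - 1/2 = - (\<sigma> x - 1/2)"
    and "C2_real \<sigma>" and "concave_on {0..} \<sigma>"
    and "\<sigma> \<in> O[at_bot](\<lambda>x. \<bar>x\<bar> powr (- 1 - \<alpha>))"
    and "\<alpha> > \<theta> / (1 - \<theta>)" and "\<theta> / (1 - \<theta>) \<ge> 2"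
    and "c1 > 0" and "c2 > 0"
    and "N > 0" and "M > 0"
    and "digital_image N M f"
  shows "\<exists>K>0. \<forall>\<^sub>F n :: nat in sequentially.
    \<bar>1 - cSSIM c1 c2 N M f (NN_op \<sigma> N M n f)\<bar>
      \<le> (4 / (covar N M f f + c2) + 1 / ((mean N M f)\<^sup>2 + c1))
          * 255\<^sup>2 * real M * real N * (K / real n powr \<theta>)"
proof -
  interpret odd_sigmoid \<sigma>
  proof
    show "\<sigma> (- x) = 1 - \<sigma> x" for x
      using assms(5)[rule_format, of x] by simp
  qed (use assms in auto)
  interpret prob_space "nu N M"
    using assms by (intro prob_space_nu)
  have half: "1 / 2 < \<sigma> 1"
    using assms(7) by (rule half_less_if_concave)
  obtain C where C: "C > 0" "\<And>t. t \<ge> 0 \<Longrightarrow> \<sigma> (1 - t) \<le> C / (1 + t\<^sup>2)"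
    using quadratic_tail_bound[OF assms(8)] assms(9,10) by auto
  define A where "A = 1 / (covar N M f f + c2) + 1 / ((mean N M f)\<^sup>2 + c1)"
  define A' where "A' = 4 / (covar N M f f + c2) + 1 / ((mean N M f)\<^sup>2 + c1)"
  define D where "D = \<sigma> 1 - 1 / 2"
  \<comment> \<open>\<open>4 * pi / n\<close> bounds the mean of the bumps and \<open>C / D\<close> their coefficient relative to 255.
    The factor \<open>255\<^sup>2\<close> arises as the height of the pointwise error times the bound that turns the
    squared error into the absolute one.\<close>
  define K where "K = 4 * pi * (C / D)"
  have D: "D > 0" and K: "K > 0"
    using half C by (simp_all add: D_def K_def)
  have "0 \<le> covar N M f f"
    unfolding covar_def by (intro Bochner_Integration.integral_nonneg) simp
  then have A: "0 \<le> A" "A \<le> A'"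
    using assms by (auto simp: A_def A'_def intro!: add_nonneg_nonneg divide_right_mono)
  have f: "0 \<le> f x \<and> f x \<le> 255" if "x \<in> image_domain N M" for x
    using digital_image_range[OF assms(15,13,14) that] .
  have "\<bar>1 - cSSIM c1 c2 N M f (NN_op \<sigma> N M n f)\<bar> \<le> A' * 255\<^sup>2 * real M * real N * (K / real n powr \<theta>)"
    if n: "n > 0" for n
  proof -
    let ?g = "NN_op \<sigma> N M n f"
    let ?h = "\<lambda>x. edge_bumps N n (fst x) + edge_bumps M n (snd x)"
    have g: "0 \<le> ?g x \<and> ?g x \<le> 255" if "x \<in> image_domain N M" for x
      using n that half f by (rule NN_op_bounds)
    have meas: "f \<in> borel_measurable (nu N M)" "?g \<in> borel_measurable (nu N M)" "?h \<in> borel_measurable (nu N M)"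
      using assms(15) by (auto intro: borel_measurable_digital_image borel_measurable_NN_op borel_measurable_nu
          borel_measurable_edge_bumps)
    have h: "integrable (nu N M) ?h"
    proof (rule integrable_const_bound)
      show "AE x in nu N M. norm (?h x) \<le> real (N + 1) + real (M + 1)"
      proof (rule AE_I2)
        show "norm (?h x) \<le> real (N + 1) + real (M + 1)" for x
          using edge_bumps_nonneg[of N n "fst x"] edge_bumps_nonneg[of M n "snd x"]
            edge_bumps_le[of N n "fst x"] edge_bumps_le[of M n "snd x"] by simp
      qed
    qed (rule meas)
    have "\<bar>1 - cSSIM c1 c2 N M f ?g\<bar> \<le> A * (255 * (\<integral>x. \<bar>f x - ?g x\<bar> \<partial>nu N M))"
      unfolding A_def cSSIM_def covar_def mean_def
      using meas f g assms(11,12) by (intro one_minus_SSIM_le) (auto simp: space_nu)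
    also have "\<dots> \<le> A * (255 * (\<integral>x. 255 * (C / D) * ?h x \<partial>nu N M))"
    proof (intro mult_left_mono integral_mono')
      show "\<bar>f x - ?g x\<bar> \<le> 255 * (C / D) * ?h x" if "x \<in> space (nu N M)" for x
        using NN_op_pointwise_error[OF C half assms(15,13,14) n] that unfolding space_nu D_def by blast
      show "0 \<le> 255 * (C / D) * ?h x" for x
        using C D by (intro mult_nonneg_nonneg add_nonneg_nonneg) (auto simp: edge_bumps_nonneg)
    qed (use h A in auto)
    also have "\<dots> = A * 255\<^sup>2 * (C / D) * (\<integral>x. ?h x \<partial>nu N M)"
      by (simp add: power2_eq_square)
    also have "\<dots> \<le> A * 255\<^sup>2 * (C / D) * (4 * pi / real n)"
      using integral_nu_edge_bumps_le[of N M n] assms(13,14) n C D A by (intro mult_left_mono) auto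
    also have "\<dots> = A * 255\<^sup>2 * 1 * 1 * (K / real n)"
      by (simp add: K_def)
    also have "\<dots> \<le> A' * 255\<^sup>2 * real M * real N * (K / real n powr \<theta>)"
    proof (intro mult_mono divide_left_mono)
      have "real n powr \<theta> \<le> real n powr 1"
        using n assms(2) by (intro powr_mono) auto
      then show "real n powr \<theta> \<le> real n"
        using n by simp
    qed (use n A K assms(13,14) in auto)
    finally show ?thesis .
  qed
  then have "\<forall>\<^sub>F n :: nat in sequentially. \<bar>1 - cSSIM c1 c2 N M f (NN_op \<sigma> N M n f)\<bar>
      \<le> A' * 255\<^sup>2 * real M * real N * (K / real n powr \<theta>)"
    by (rule eventually_mono[OF eventually_gt_at_top[of 0]])
  with K show ?thesis
    unfolding A'_def by blast
qed

end
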